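(* Let $p\in[1,\infty)$, let $P,Q$ be probability measures on $\mathbb R$, and let $M,L$ be positive integers. For positive constants $\alpha,\delta,\epsilon$ and $K$, suppose that $$P(B_m)+Q(B_m)\le K2^{-(2p+\delta)m}\quad\text{for all }m\ge0, \tag{a}$$ and $$\big|P(\pi_m^{-1}(F)\cap B_m)-Q(\pi_m^{-1}(F)\cap B_m)\big|\le\frac{K(2+\alpha)^{-mp}\epsilon}{(l+1)^2}\quad\text{for all }0\le m\le M,\ 0\le l\le L,\ F\in\mathcal P_l. \tag{b}$$ Then $$W_p^p(P,Q)\le K'\big[2^{-Lp}+\epsilon+2^{-(p+\delta)M}\big],$$ where $K'$ is a constant depending only on $\alpha,K$ and $p$. If $p>1$, the same conclusion holds with condition (b) replaced by the weaker condition $$\big|P(\pi_m^{-1}(F)\cap B_m)-Q(\pi_m^{-1}(F)\cap B_m)\big|\le K(2+\alpha)^{-mp}\epsilon\quad\text{for all }0\le m\le M,\ 0\le l\le L,\ F\in\mathcal P_l.$$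
   Context: Notation: $B_0=(-1,1]$ and $B_m=(-2^m,2^m]\setminus(-2^{m-1},2^{m-1}]$ for integers $m\ge1$. $\pi_m:\mathbb R\to\mathbb R$, $\pi_m(x)=x/2^m$. For integers $l\ge0$, $\mathcal P_l=\{(-1+k2^{1-l},-1+(k+1)2^{1-l}]:k=0,1,\ldots,2^l-1\}$, a partition of $(-1,1]$. $W_p(P,Q)=\inf_{\pi}\big(\int_{\mathbb R^2}|x-y|^p\,d\pi(x,y)\big)^{1/p}$, the infimum being over all couplings $\pi$ of $P$ and $Q$; $W_p^p=(W_p)^p$. *)

theory Defs
  imports "HOL-Probability.Probability"
begin

definition dyadic_shell :: "nat \<Rightarrow> real set" where
  "dyadic_shell m =
     (if m = 0 then {-1<..1} else {-(2 ^ m)<..2 ^ m} - {-(2 ^ (m - 1))<..2 ^ (m - 1)})"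

definition dyadic_scale :: "nat \<Rightarrow> real \<Rightarrow> real" where
  "dyadic_scale m x = x / 2 ^ m"

definition dyadic_partition :: "nat \<Rightarrow> real set set" where
  "dyadic_partition l =
     {{-1 + real k * 2 powr (1 - real l) <.. -1 + (real k + 1) * 2 powr (1 - real l)} | k.
       k < 2 ^ l}"

text \<open>Powers with a positive exponent on \<open>[0,\<infinity>]\<close>; the exponents used below are
  \<open>p\<close> and \<open>1 / p\<close> with \<open>p \<ge> 1\<close>.\<close>

definition ennreal_powr :: "ennreal \<Rightarrow> real \<Rightarrow> ennreal" where
  "ennreal_powr x r = (if x = \<infinity> then \<infinity> else ennreal (enn2real x powr r))"

definition couplings :: "real measure \<Rightarrow> real measure \<Rightarrow> (real \<times> real) measure set" where
  "couplings P Q =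
     {R. prob_space R \<and> sets R = sets (borel \<Otimes>\<^sub>M borel) \<and>
         distr R borel fst = P \<and> distr R borel snd = Q}"

text \<open>The distance takes values in \<open>[0,\<infinity>]\<close>, since no moments of the measures are assumed
  in the definition.\<close>

definition wasserstein :: "real \<Rightarrow> real measure \<Rightarrow> real measure \<Rightarrow> ennreal" where
  "wasserstein p P Q =
     (INF R \<in> couplings P Q.
        ennreal_powr (\<integral>\<^sup>+ z. ennreal (\<bar>fst z - snd z\<bar> powr p) \<partial>R) (1 / p))"

definition prob_on_real :: "real measure \<Rightarrow> bool" where
  "prob_on_real P \<longleftrightarrow> prob_space P \<and> sets P = sets borel"

definition cell_discrepancy :: "real measure \<Rightarrow> real measure \<Rightarrow> nat \<Rightarrow> real set \<Rightarrow> real" where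
  "cell_discrepancy P Q m F =
     \<bar>measure P (dyadic_scale m -` F \<inter> dyadic_shell m)
        - measure Q (dyadic_scale m -` F \<inter> dyadic_shell m)\<bar>"

end

theory Submission
  imports Defs
begin

text \<open>
  Couple \<open>P\<close> and \<open>Q\<close> by their quantile functions.  Then a point \<open>t\<close> separates
  the two coordinates with probability exactly \<open>\<bar>F(t) - G(t)\<bar>\<close>, the difference of the distribution functions.
  Choosing a dyadic grid whose mesh is comparable to the distance, \<open>\<bar>x - y\<bar> ^ p\<close> is at most
  a weighted count of the grid points separating \<open>x\<close> and \<open>y\<close>: a sum over all levels for
  \<open>p > 1\<close>, but the finest level alone for \<open>p = 1\<close>, where the sum over levels would cost a factor \<open>L\<close>.
  On the line, the mass beyond a grid point of level \<open>l\<close> splits into one cell of each level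
  \<open>\<le> l\<close>, so \<open>\<bar>F(t) - G(t)\<bar>\<close> is controlled by the sum of the cell discrepancies over the levels,
  plus the contribution of the shells further out.
\<close>

subsection \<open>Distances and separating grid points\<close>

text \<open>The non-strict inequality matches \<open>cdf\<close>, whose value at \<open>t\<close> is
  the mass of the points \<open>\<le> t\<close>.\<close>

definition separates :: "real \<Rightarrow> real \<Rightarrow> real \<Rightarrow> bool" where
  "separates t x y \<longleftrightarrow> (x \<le> t) \<noteq> (y \<le> t)"

definition grid :: "nat \<Rightarrow> nat \<Rightarrow> nat \<Rightarrow> real" where
  "grid m l k = 2 ^ m * (-1 + real k * 2 powr (1 - real l))"

text \<open>These are the end points of the cells of level \<open>l\<close>, scaled to the size of
  the shell. Both outer end points and, where they are grid points, both inner ones are kept, so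
  that intervals ending at a shell boundary are covered.\<close>

definition grid_indices :: "nat \<Rightarrow> nat \<Rightarrow> nat set" where
  "grid_indices m l = {k. k \<le> 2 ^ l \<and> (m = 0 \<or> 2 ^ (m - 1) \<le> \<bar>grid m l k\<bar>)}"

definition separation_count :: "nat \<Rightarrow> nat \<Rightarrow> real \<Rightarrow> real \<Rightarrow> real" where
  "separation_count m l x y = (\<Sum>k\<in>grid_indices m l. of_bool (separates (grid m l k) x y))"

text \<open>\<open>L\<close> is the finest level in use, and \<open>W\<close> is the set of levels whose grid points are
  counted.\<close>

definition shell_cost :: "real \<Rightarrow> nat \<Rightarrow> nat set \<Rightarrow> nat \<Rightarrow> real \<Rightarrow> real \<Rightarrow> real" where
  "shell_cost p L W m x y =
     2 powr (real m * p) *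
       (2 powr (- real L * p) * (indicator (dyadic_shell m) x + indicator (dyadic_shell m) y)
        + (\<Sum>l\<in>W. 2 powr (- real l * p) * separation_count m l x y))"

lemma separates_commute: "separates t x y \<longleftrightarrow> separates t y x"
  by (auto simp: separates_def)

lemma shell_cost_commute: "shell_cost p L W m x y = shell_cost p L W m y x"
  by (simp add: shell_cost_def separation_count_def separates_commute[of _ x y] add.commute)

lemma finite_grid_indices [simp]: "finite (grid_indices m l)"
  by (rule finite_subset[of _ "{..2 ^ l}"]) (auto simp: grid_indices_def)

lemma separation_count_nonneg [simp]: "0 \<le> separation_count m l x y"
  by (auto simp: separation_count_def intro: sum_nonneg)

lemma shell_cost_nonneg [simp]: "0 \<le> shell_cost p L W m x y"
  by (auto simp: shell_cost_def intro!: mult_nonneg_nonneg add_nonneg_nonneg sum_nonneg)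

lemma grid_eq: "grid m l k = - (2 ^ m) + real k * (2 * 2 ^ m / 2 ^ l)"
  by (simp add: grid_def powr_diff powr_realpow field_simps)

lemma card_le_separation_count:
  assumes "A \<subseteq> grid_indices m l" and "\<And>k. k \<in> A \<Longrightarrow> separates (grid m l k) x y"
  shows "real (card A) \<le> separation_count m l x y"
proof -
  have "real (card A) = (\<Sum>k\<in>A. of_bool (separates (grid m l k) x y))"
    using assms(2) by simp
  also have "\<dots> \<le> separation_count m l x y"
    unfolding separation_count_def by (rule sum_mono2) (use assms(1) in auto)
  finally show ?thesis .
qed

text \<open>An interval \<open>[x, y)\<close> of length \<open>d\<close> contains at least
  \<open>d / h - 1\<close> points of a grid of mesh \<open>h\<close>. Hypothesis \<open>half\<close>
  puts both points on the same side of the hole of the shell, so that none of these grid points is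
  excluded from \<open>grid_indices\<close>.\<close>

lemma gap_le_separation_count:
  assumes "x < y" and "- (2 ^ m) < x" and "y \<le> 2 ^ m"
    and half: "m = 0 \<or> 2 ^ (m - 1) < x \<or> y \<le> - (2 ^ (m - 1))"
  shows "y - x \<le> 2 * 2 ^ m / 2 ^ l * (separation_count m l x y + 1)"
proof -
  define h :: real where "h = 2 * 2 ^ m / 2 ^ l"
  have h: "h > 0" by (simp add: h_def)
  \<comment> \<open>Index \<open>k\<close> satisfies \<open>x \<le> grid m l k < y\<close> exactly
    if it lies in \<open>{a..<b}\<close>; the ceilings encode this half-open convention.\<close>
  define a b where "a = \<lceil>(x + 2 ^ m) / h\<rceil>" and "b = \<lceil>(y + 2 ^ m) / h\<rceil>"
  have "(x + 2 ^ m) / h \<le> (y + 2 ^ m) / h" "0 \<le> (x + 2 ^ m) / h"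
    using assms(1,2) h by (simp_all add: divide_right_mono)
  then have ab: "a \<le> b" "0 \<le> a"
    unfolding a_def b_def by (simp_all add: ceiling_mono)
  have "(y + 2 ^ m) / h \<le> 2 ^ l"
    using assms(3) h by (simp add: pos_divide_le_eq) (simp add: h_def)
  then have "b \<le> 2 ^ l"
    unfolding b_def by (simp add: ceiling_le_iff)
  have bounds: "x \<le> grid m l k \<and> grid m l k < y \<and> k \<le> 2 ^ l" if "k \<in> nat ` {a..<b}" for k
  proof -
    have k: "a \<le> int k" "int k < b" using that ab by auto
    have "(x + 2 ^ m) / h \<le> real k"
      using k(1) unfolding a_def by (simp add: ceiling_le_iff)
    moreover have "real k < (y + 2 ^ m) / h"
      using k(2) unfolding b_def by (simp add: less_ceiling_iff)
    moreover have "int k \<le> 2 ^ l" using k(2) \<open>b \<le> 2 ^ l\<close> by linarith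
    then have "k \<le> 2 ^ l" by (metis of_nat_le_iff of_nat_numeral of_nat_power)
    ultimately show ?thesis using h
      unfolding grid_eq h_def[symmetric]
      by (simp add: pos_divide_le_eq pos_less_divide_eq)
  qed
  have "nat ` {a..<b} \<subseteq> grid_indices m l"
  proof
    fix k assume "k \<in> nat ` {a..<b}"
    from bounds[OF this] half show "k \<in> grid_indices m l"
      unfolding grid_indices_def by auto
  qed
  then have "real (card (nat ` {a..<b})) \<le> separation_count m l x y"
    by (rule card_le_separation_count) (use bounds in \<open>force simp: separates_def\<close>)
  moreover have "card (nat ` {a..<b}) = nat (b - a)"
    using ab by (subst card_image) (auto simp: inj_on_def)
  moreover have "(y - x) / h \<le> real_of_int (b - a) + 1"
  proof -
    have "(y - x) / h = (y + 2 ^ m) / h - (x + 2 ^ m) / h"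
      by (simp flip: diff_divide_distrib)
    then show ?thesis unfolding a_def b_def by linarith
  qed
  ultimately have "(y - x) / h \<le> separation_count m l x y + 1"
    using ab by simp
  then show ?thesis using h unfolding h_def[symmetric] by (simp add: pos_divide_le_eq mult.commute)
qed

lemma powr_powr_scale: "(4 * 2 ^ m / 2 ^ l) powr p = 4 powr p * (2 powr (real m * p) * 2 powr (- real l * p))"
  by (simp add: powr_mult powr_divide powr_powr powr_minus_divide flip: powr_realpow)

text \<open>A gap below the finest mesh is paid for by the indicator term. A larger gap is charged
  to a level of comparable mesh, or, for \<open>p = 1\<close>, to the count on level
  \<open>L\<close>, which is linear in the gap.\<close>

lemma powr_gap_le_shell_cost:
  assumes "x < y" and "- (2 ^ m) < x" and "y \<le> 2 ^ m"
    and half: "m = 0 \<or> 2 ^ (m - 1) < x \<or> y \<le> - (2 ^ (m - 1))"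
    and "x \<in> dyadic_shell m" and "1 \<le> p" and fin: "finite W"
    and W: "{..L} \<subseteq> W \<or> p = 1 \<and> L \<in> W"
  shows "(y - x) powr p \<le> 4 powr p * shell_cost p L W m x y"
proof -
  define h where "h l = 2 * 2 ^ m / (2 ^ l :: real)" for l
  define N where "N l = separation_count m l x y" for l
  have h: "h l > 0" for l by (simp add: h_def)
  have N: "0 \<le> N l" for l by (simp add: N_def)
  have gap: "y - x \<le> h l * (N l + 1)" for l
    unfolding h_def N_def by (rule gap_le_separation_count) (use assms in auto)
  have h2: "(2 * h l) powr p = 4 powr p * (2 powr (real m * p) * 2 powr (- real l * p))" for l
    unfolding powr_powr_scale[symmetric] by (simp add: h_def)
  \<comment> \<open>The finest mesh plus the contribution of a single level of \<open>W\<close> is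
    all that the cases below need. The mesh is doubled because the level selected later has mesh
    only at least half the gap; this gives the factor \<open>4 powr p\<close>.\<close>
  have cost: "(2 * h L) powr p + (2 * h l) powr p * N l \<le> 4 powr p * shell_cost p L W m x y"
    if "l \<in> W" for l
  proof -
    have "2 powr (- real l * p) * N l \<le> (\<Sum>l\<in>W. 2 powr (- real l * p) * N l)"
      by (rule member_le_sum) (use that fin N in auto)
    moreover have "2 powr (- real L * p) * 1 \<le>
      2 powr (- real L * p) * (indicator (dyadic_shell m) x + indicator (dyadic_shell m) y)"
      using \<open>x \<in> dyadic_shell m\<close> by (intro mult_left_mono) auto
    ultimately have "2 powr (- real L * p) + 2 powr (- real l * p) * N l \<le>
       (2 powr (- real L * p) * (indicator (dyadic_shell m) x + indicator (dyadic_shell m) y)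
        + (\<Sum>l\<in>W. 2 powr (- real l * p) * N l))" by linarith
    from mult_left_mono[OF this, of "4 powr p * 2 powr (real m * p)"]
    show ?thesis unfolding h2 shell_cost_def N_def
      by (simp only: distrib_left mult.assoc) simp
  qed
  show ?thesis
  proof (cases "y - x \<le> h L")
    case True
    have "(y - x) powr p \<le> (2 * h L) powr p"
      by (rule powr_mono2) (use True assms(1,6) h[of L] in auto)
    also have "\<dots> \<le> (2 * h L) powr p + (2 * h L) powr p * N L"
      using N by simp
    also have "\<dots> \<le> 4 powr p * shell_cost p L W m x y" using W cost by blast
    finally show ?thesis .
  next
    case False
    then have gt: "h L < y - x" by simp
    from W show ?thesis
    proof
      assume W: "{..L} \<subseteq> W"
      \<comment> \<open>The coarsest level with mesh below the gap: the previous level has twice the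
        mesh and is not below the gap, hence \<open>y - x \<le> 2 * h l\<close>. Level 0 is ruled
        out since its mesh is the diameter of the ball.\<close>
      define l where "l = (LEAST l. h l < y - x)"
      have l: "h l < y - x" unfolding l_def by (rule LeastI) (rule gt)
      have "l \<le> L" unfolding l_def by (rule Least_le) (rule gt)
      have "h 0 \<ge> y - x" using assms(2,3) by (simp add: h_def)
      with l have "l \<noteq> 0" by (metis not_le)
      then obtain j where j: "l = Suc j" by (cases l) auto
      have "\<not> h j < y - x" using not_less_Least[of j "\<lambda>l. h l < y - x"] j l_def by simp
      then have le: "y - x \<le> 2 * h l" by (simp add: h_def j)
      \<comment> \<open>The gap exceeds the mesh, so the count is positive; being a cardinality, it
        is at least 1.\<close>
      have "h l * 1 < h l * (N l + 1)" using l gap[of l] by linarith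
      then have "0 < N l" using h[of l] by (simp add: mult_less_cancel_left)
      have N1: "1 \<le> N l"
      proof -
        have "N l = real (card (grid_indices m l \<inter> {k. separates (grid m l k) x y}))"
          by (simp add: N_def separation_count_def)
        with \<open>0 < N l\<close> show ?thesis by simp
      qed
      have "(y - x) powr p \<le> (2 * h l) powr p"
        by (rule powr_mono2) (use le assms(1,6) in auto)
      also have "\<dots> \<le> (2 * h l) powr p * N l"
        using N1 by (simp add: mult_le_cancel_left1)
      also have "\<dots> \<le> (2 * h L) powr p + (2 * h l) powr p * N l" by simp
      also have "\<dots> \<le> 4 powr p * shell_cost p L W m x y"
        by (rule cost) (use W \<open>l \<le> L\<close> in auto)
      finally show ?thesis .
    next
      assume W: "p = 1 \<and> L \<in> W"
      have "y - x \<le> h L + h L * N L" using gap[of L] by (simp add: algebra_simps)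
      also have "\<dots> \<le> 2 * (h L + h L * N L)" using h[of L] N[of L] by simp
      also have "\<dots> = (2 * h L) powr p + (2 * h L) powr p * N L"
        using W h[of L] by (simp add: algebra_simps)
      also have "\<dots> \<le> 4 powr p * shell_cost p L W m x y" by (rule cost) (use W in auto)
      finally show ?thesis using W assms(1) by simp
    qed
  qed
qed

lemma grid_level_0: "grid m 0 0 = - (2 ^ m)" "grid m 0 1 = 2 ^ m"
  by (simp_all add: grid_eq)

lemma grid_indices_level_0: "grid_indices m 0 = {0, 1}"
proof -
  have "2 ^ (m - 1) \<le> (2::real) ^ m" by simp
  then show ?thesis
    using grid_level_0[of m] by (auto simp: grid_indices_def le_Suc_eq)
qed

text \<open>If \<open>x\<close> and \<open>y\<close> lie in different half-shells, the distance is charged to an end point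
  of the next smaller shell.\<close>

lemma powr_cross_gap_le_shell_cost:
  assumes "x < y" and "y - x \<le> 4 * 2 ^ m"
    and sep: "separates (2 ^ m) x y \<or> separates (- (2 ^ m)) x y"
    and "1 \<le> p" and fin: "finite W" and W: "0 \<in> W"
  shows "(y - x) powr p \<le> 4 powr p * shell_cost p L W m x y"
proof -
  have "(y - x) powr p \<le> (4 * 2 ^ m / 2 ^ 0) powr p"
    by (rule powr_mono2) (use assms in auto)
  also have "\<dots> = 4 powr p * (2 powr (real m * p) * 2 powr (- real 0 * p))"
    by (rule powr_powr_scale)
  also have "2 powr (- real 0 * p) \<le> 2 powr (- real 0 * p) * separation_count m 0 x y"
    using sep by (auto simp: separation_count_def grid_indices_level_0 grid_level_0 grid_level_0(2)[simplified] simp del: sum_of_bool_eq)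
  also have "\<dots> \<le> (\<Sum>l\<in>W. 2 powr (- real l * p) * separation_count m l x y)"
    by (rule member_le_sum) (use fin W in auto)
  also have "\<dots> \<le> 2 powr (- real L * p) * (indicator (dyadic_shell m) x + indicator (dyadic_shell m) y) + \<dots>"
    by simp
  finally show ?thesis by (simp add: shell_cost_def)
qed

text \<open>Take the least \<open>m\<close> such that both points lie in \<open>(-2^m, 2^m]\<close>.
  Either they lie in the same half of shell \<open>m\<close> (or \<open>m = 0\<close>), and the gap
  is measured by the grids of that shell, or a boundary point of radius \<open>2^(m-1)\<close>
  separates them, and level 0 of shell \<open>m - 1\<close> pays.\<close>

lemma ex_powr_dist_le_shell_cost:
  fixes L :: "nat \<Rightarrow> nat" and W :: "nat \<Rightarrow> nat set"
  assumes "1 \<le> p" and fin: "\<And>m. finite (W m)" and W0: "\<And>m. 0 \<in> W m"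
    and W: "\<And>m. {..L m} \<subseteq> W m \<or> p = 1 \<and> L m \<in> W m"
  shows "\<exists>m. \<bar>x - y\<bar> powr p \<le> 4 powr p * shell_cost p (L m) (W m) m x y"
proof -
  have main: "\<exists>m. (y - x) powr p \<le> 4 powr p * shell_cost p (L m) (W m) m x y" if "x < y" for x y
  proof -
    define inC where "inC m \<longleftrightarrow> - (2 ^ m) < x \<and> y \<le> 2 ^ m" for m
    obtain n where "max (- x) y < 2 ^ n" using real_arch_pow[of 2 "max (- x) y"] by auto
    then have "inC n" by (auto simp: inC_def)
    define m where "m = (LEAST m. inC m)"
    have m: "- (2 ^ m) < x" "y \<le> 2 ^ m"
      using LeastI[of inC, OF \<open>inC n\<close>] by (auto simp: m_def inC_def)
    have min: "\<not> inC j" if "j < m" for j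
      using not_less_Least that by (simp add: m_def)
    show ?thesis
    proof (cases "m = 0")
      case True
      have "x \<in> dyadic_shell m" using m \<open>x < y\<close> True by (auto simp: dyadic_shell_def)
      with m \<open>x < y\<close> True assms show ?thesis
        by (intro exI[of _ m] powr_gap_le_shell_cost) auto
    next
      case False
      then obtain j where j: "m = Suc j" by (cases m) auto
      show ?thesis
      proof (cases "separates (2 ^ j) x y \<or> separates (- (2 ^ j)) x y")
        case True
        \<comment> \<open>Both points lie in a ball of diameter \<open>2 * 2 ^ Suc j\<close>, which
          is the bound \<open>4 * 2 ^ j\<close> on the gap.\<close>
        then show ?thesis using m \<open>x < y\<close> assms unfolding j
          by (intro exI[of _ j] powr_cross_gap_le_shell_cost) auto
      next
        case sep: False
        have "\<not> inC j" using min j by simp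
        then have half: "2 ^ j < x \<or> y \<le> - (2 ^ j)"
          using sep \<open>x < y\<close> by (auto simp: separates_def inC_def)
        then have "x \<in> dyadic_shell m" using m \<open>x < y\<close>
          by (auto simp: dyadic_shell_def j)
        with m \<open>x < y\<close> half assms show ?thesis
          by (intro exI[of _ m] powr_gap_le_shell_cost) (auto simp: j)
      qed
    qed
  qed
  consider "x < y" | "y < x" | "x = y" by linarith
  then show ?thesis
  proof cases
    case 1 then show ?thesis using main[of x y] by simp
  next
    case 2 then show ?thesis using main[of y x] by (subst shell_cost_commute) simp
  next
    case 3 then show ?thesis by simp
  qed
qed

subsection \<open>The quantile coupling\<close>

lemma prob_on_real_cdf_distribution: "prob_on_real P \<Longrightarrow> cdf_distribution P"
  by (simp add: prob_on_real_def cdf_distribution_def real_distribution_def real_distribution_axioms_def)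

lemma measure_unit_interval_Ioc:
  fixes a b :: real
  assumes "0 \<le> a" "a \<le> b" "b \<le> 1"
  shows "measure lborel ({0<..<1} \<inter> {a<..b}) = b - a"
proof (cases "b = 1")
  case True
  then have "{0<..<1} \<inter> {a<..b} = {a<..<b}" using assms by auto
  then show ?thesis using assms by simp
next
  case False
  then have "{0<..<1} \<inter> {a<..b} = {a<..b}" using assms by auto
  then show ?thesis using assms by simp
qed

text \<open>On \<open>(0,1)\<close> with Lebesgue measure, the quantile function of \<open>P\<close>
  at \<open>\<omega>\<close> is \<open>\<le> t\<close> exactly if
  \<open>\<omega> \<le> cdf P t\<close>. Hence \<open>t\<close> separates the two quantiles exactly
  between the two values of the distribution functions.\<close>

lemma quantile_coupling:
  assumes "prob_on_real P" and "prob_on_real Q"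
  obtains \<Omega> :: "real measure" and X Y where
    "prob_space \<Omega>" "X \<in> borel_measurable \<Omega>" "Y \<in> borel_measurable \<Omega>"
    "distr \<Omega> borel X = P" "distr \<Omega> borel Y = Q"
    "\<And>t. measure \<Omega> {\<omega>\<in>space \<Omega>. separates t (X \<omega>) (Y \<omega>)} = \<bar>cdf P t - cdf Q t\<bar>"
proof -
  interpret P: cdf_distribution P by (rule prob_on_real_cdf_distribution) fact
  interpret Q: cdf_distribution Q by (rule prob_on_real_cdf_distribution) fact
  let ?\<Omega> = "restrict_space lborel {0<..<1} :: real measure"
  have meas: "f \<in> borel_measurable ?\<Omega>" if "f \<in> borel_measurable (restrict_space borel {0<..<1})"
    for f :: "real \<Rightarrow> real"
    using that by (simp cong: measurable_cong_sets add: sets_restrict_space)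
  have "measure ?\<Omega> {\<omega>\<in>space ?\<Omega>. separates t (P.I \<omega>) (Q.I \<omega>)} = \<bar>cdf P t - cdf Q t\<bar>" for t
  proof -
    let ?a = "min (cdf P t) (cdf Q t)" and ?b = "max (cdf P t) (cdf Q t)"
    have "{\<omega>\<in>space ?\<Omega>. separates t (P.I \<omega>) (Q.I \<omega>)} = {0<..<1} \<inter> {?a<..?b}"
      by (auto simp: space_restrict_space separates_def P.pseudoinverse[symmetric] Q.pseudoinverse[symmetric])
    moreover have "measure ?\<Omega> ({0<..<1} \<inter> {?a<..?b}) = measure lborel ({0<..<1} \<inter> {?a<..?b})"
      by (rule measure_restrict_space) auto
    moreover have "\<dots> = ?b - ?a"
      by (rule measure_unit_interval_Ioc)
        (auto simp: P.cdf_nonneg Q.cdf_nonneg P.cdf_bounded_prob Q.cdf_bounded_prob)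
    ultimately have "measure ?\<Omega> {\<omega>\<in>space ?\<Omega>. separates t (P.I \<omega>) (Q.I \<omega>)} = ?b - ?a"
      by metis
    then show ?thesis by (simp add: max_def min_def)
  qed
  moreover have "prob_space ?\<Omega>"
    by (auto simp: emeasure_restrict_space space_restrict_space intro!: prob_spaceI)
  ultimately show thesis
    using that[of ?\<Omega> P.I Q.I] P.distr_I_eq_M Q.distr_I_eq_M
      meas[OF P.measurable_CI] meas[OF Q.measurable_CI] by auto
qed

section \<open>From the quantile coupling to a bound on the Wasserstein distance\<close>

lemma ennreal_powr_mono: "x \<le> y \<Longrightarrow> 0 \<le> r \<Longrightarrow> ennreal_powr x r \<le> ennreal_powr y r"
  by (auto simp: ennreal_powr_def top_unique less_top intro!: ennreal_leI powr_mono2 enn2real_mono)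

lemma ennreal_powr_ennreal: "0 \<le> x \<Longrightarrow> ennreal_powr (ennreal x) r = ennreal (x powr r)"
  by (simp add: ennreal_powr_def)

text \<open>The joint law of \<open>X\<close> and \<open>Y\<close> is one of the couplings in the
  infimum, and the exponents \<open>1 / p\<close> and \<open>p\<close> cancel.\<close>

lemma wasserstein_powr_le:
  assumes "prob_space \<Omega>" and [measurable]: "X \<in> borel_measurable \<Omega>" "Y \<in> borel_measurable \<Omega>"
    and "distr \<Omega> borel X = P" and "distr \<Omega> borel Y = Q"
    and "0 < p" and "0 \<le> B"
    and le: "(\<integral>\<^sup>+ \<omega>. ennreal (\<bar>X \<omega> - Y \<omega>\<bar> powr p) \<partial>\<Omega>) \<le> ennreal B"
  shows "ennreal_powr (wasserstein p P Q) p \<le> ennreal B"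
proof -
  let ?R = "distr \<Omega> (borel \<Otimes>\<^sub>M borel) (\<lambda>\<omega>. (X \<omega>, Y \<omega>))"
  interpret prob_space \<Omega> by fact
  have "prob_space ?R" by (rule prob_space_distr) measurable
  moreover have "distr ?R borel fst = P" "distr ?R borel snd = Q"
    using assms(4,5) by (simp_all add: distr_distr comp_def)
  ultimately have "?R \<in> couplings P Q" by (simp add: couplings_def)
  then have "wasserstein p P Q \<le>
      ennreal_powr (\<integral>\<^sup>+ z. ennreal (\<bar>fst z - snd z\<bar> powr p) \<partial>?R) (1 / p)"
    unfolding wasserstein_def by (rule INF_lower)
  also have "(\<integral>\<^sup>+ z. ennreal (\<bar>fst z - snd z\<bar> powr p) \<partial>?R)
      = (\<integral>\<^sup>+ \<omega>. ennreal (\<bar>X \<omega> - Y \<omega>\<bar> powr p) \<partial>\<Omega>)"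
    by (subst nn_integral_distr) auto
  also have "ennreal_powr \<dots> (1 / p) \<le> ennreal_powr (ennreal B) (1 / p)"
    by (rule ennreal_powr_mono) (use le \<open>0 < p\<close> in auto)
  finally have "ennreal_powr (wasserstein p P Q) p
      \<le> ennreal_powr (ennreal_powr (ennreal B) (1 / p)) p"
    by (rule ennreal_powr_mono) (use \<open>0 < p\<close> in auto)
  also have "\<dots> = ennreal B"
    using assms(6,7) by (simp add: ennreal_powr_ennreal powr_powr)
  finally show ?thesis .
qed

lemma dyadic_shell_borel [measurable]: "dyadic_shell m \<in> sets borel"
  by (simp add: dyadic_shell_def)

text \<open>Under the quantile coupling this is the expectation of
  \<open>separation_count\<close>.\<close>

definition grid_discrepancy :: "real measure \<Rightarrow> real measure \<Rightarrow> nat \<Rightarrow> nat \<Rightarrow> real" where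
  "grid_discrepancy P Q m l = (\<Sum>k\<in>grid_indices m l. \<bar>cdf P (grid m l k) - cdf Q (grid m l k)\<bar>)"

definition expected_shell_cost ::
    "real measure \<Rightarrow> real measure \<Rightarrow> real \<Rightarrow> nat \<Rightarrow> nat set \<Rightarrow> nat \<Rightarrow> real" where
  "expected_shell_cost P Q p L W m =
     2 powr (real m * p) *
       (2 powr (- real L * p) * (measure P (dyadic_shell m) + measure Q (dyadic_shell m))
        + (\<Sum>l\<in>W. 2 powr (- real l * p) * grid_discrepancy P Q m l))"

text \<open>The cost is a finite linear combination of indicators, whose expectations are shell
  masses and separation probabilities.\<close>

lemma has_bochner_integral_shell_cost:
  assumes "prob_space \<Omega>" and [measurable]: "X \<in> borel_measurable \<Omega>" "Y \<in> borel_measurable \<Omega>"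
    and PQ: "distr \<Omega> borel X = P" "distr \<Omega> borel Y = Q"
    and sep: "\<And>t. measure \<Omega> {\<omega>\<in>space \<Omega>. separates t (X \<omega>) (Y \<omega>)} = \<bar>cdf P t - cdf Q t\<bar>"
  shows "has_bochner_integral \<Omega> (\<lambda>\<omega>. shell_cost p L W m (X \<omega>) (Y \<omega>))
           (expected_shell_cost P Q p L W m)"
proof -
  interpret prob_space \<Omega> by fact
  have shell: "has_bochner_integral \<Omega> (\<lambda>\<omega>. indicator (dyadic_shell m) (Z \<omega>))
      (measure (distr \<Omega> borel Z) (dyadic_shell m))"
    if [measurable]: "Z \<in> borel_measurable \<Omega>" for Z
  proof -
    have "has_bochner_integral \<Omega> (indicator (Z -` dyadic_shell m \<inter> space \<Omega>) :: _ \<Rightarrow> real)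
        (measure \<Omega> (Z -` dyadic_shell m \<inter> space \<Omega>))"
      by (rule has_bochner_integral_real_indicator) (auto simp: less_top[symmetric])
    also have "has_bochner_integral \<Omega> (indicator (Z -` dyadic_shell m \<inter> space \<Omega>) :: _ \<Rightarrow> real)
        (measure \<Omega> (Z -` dyadic_shell m \<inter> space \<Omega>)) \<longleftrightarrow>
      has_bochner_integral \<Omega> (\<lambda>\<omega>. indicator (dyadic_shell m) (Z \<omega>))
        (measure (distr \<Omega> borel Z) (dyadic_shell m))"
      by (rule has_bochner_integral_cong) (simp_all add: indicator_def measure_distr)
    finally show ?thesis .
  qed
  have point: "has_bochner_integral \<Omega> (\<lambda>\<omega>. of_bool (separates t (X \<omega>) (Y \<omega>)))
      \<bar>cdf P t - cdf Q t\<bar>" for t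
  proof -
    have "has_bochner_integral \<Omega> (indicator {\<omega>\<in>space \<Omega>. separates t (X \<omega>) (Y \<omega>)} :: _ \<Rightarrow> real)
        (measure \<Omega> {\<omega>\<in>space \<Omega>. separates t (X \<omega>) (Y \<omega>)})"
      by (rule has_bochner_integral_real_indicator) (auto simp: less_top[symmetric] separates_def)
    also have "has_bochner_integral \<Omega>
        (indicator {\<omega>\<in>space \<Omega>. separates t (X \<omega>) (Y \<omega>)} :: _ \<Rightarrow> real)
        (measure \<Omega> {\<omega>\<in>space \<Omega>. separates t (X \<omega>) (Y \<omega>)}) \<longleftrightarrow>
      has_bochner_integral \<Omega> (\<lambda>\<omega>. of_bool (separates t (X \<omega>) (Y \<omega>)))
        \<bar>cdf P t - cdf Q t\<bar>"
      by (rule has_bochner_integral_cong) (simp_all add: indicator_def sep)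
    finally show ?thesis .
  qed
  show ?thesis
    unfolding shell_cost_def expected_shell_cost_def separation_count_def grid_discrepancy_def
    using shell[of X] shell[of Y] unfolding PQ
    by (intro has_bochner_integral_mult_right has_bochner_integral_add has_bochner_integral_sum point)
      auto
qed

text \<open>The distance is bounded by the cost of some shell depending on the sample point, hence
  by the sum over all shells, which is integrated termwise. Both \<open>L\<close> and
  \<open>W\<close> may vary with the shell, so that far shells can be treated with level 0
  alone.\<close>

lemma wasserstein_powr_le_suminf:
  fixes L :: "nat \<Rightarrow> nat" and W :: "nat \<Rightarrow> nat set"
  assumes "1 \<le> p" and PQ: "prob_on_real P" "prob_on_real Q"
    and fin: "\<And>m. finite (W m)" and W0: "\<And>m. 0 \<in> W m"
    and W: "\<And>m. {..L m} \<subseteq> W m \<or> p = 1 \<and> L m \<in> W m"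
    and B: "\<And>N. 4 powr p * (\<Sum>m<N. expected_shell_cost P Q p (L m) (W m) m) \<le> B"
  shows "ennreal_powr (wasserstein p P Q) p \<le> ennreal B"
proof -
  obtain \<Omega> :: "real measure" and X Y where *:
    "prob_space \<Omega>" "X \<in> borel_measurable \<Omega>" "Y \<in> borel_measurable \<Omega>"
    "distr \<Omega> borel X = P" "distr \<Omega> borel Y = Q"
    "\<And>t. measure \<Omega> {\<omega>\<in>space \<Omega>. separates t (X \<omega>) (Y \<omega>)} = \<bar>cdf P t - cdf Q t\<bar>"
    using quantile_coupling[OF PQ] by blast
  define c where "c m \<omega> = 4 powr p * shell_cost p (L m) (W m) m (X \<omega>) (Y \<omega>)" for m \<omega>
  define e where "e m = 4 powr p * expected_shell_cost P Q p (L m) (W m) m" for m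
  have int: "has_bochner_integral \<Omega> (c m) (e m)" for m
    unfolding c_def e_def
    by (intro has_bochner_integral_mult_right has_bochner_integral_shell_cost) (use * in auto)
  have c: "0 \<le> c m \<omega>" for m \<omega>
    by (simp add: c_def)
  have e: "0 \<le> e m" for m
    by (auto simp: e_def expected_shell_cost_def grid_discrepancy_def
        intro!: mult_nonneg_nonneg add_nonneg_nonneg sum_nonneg)
  have "(\<integral>\<^sup>+ \<omega>. ennreal (\<bar>X \<omega> - Y \<omega>\<bar> powr p) \<partial>\<Omega>) \<le> (\<integral>\<^sup>+ \<omega>. (\<Sum>m. ennreal (c m \<omega>)) \<partial>\<Omega>)"
  proof (rule nn_integral_mono)
    fix \<omega>
    have "\<exists>m. \<bar>X \<omega> - Y \<omega>\<bar> powr p \<le> c m \<omega>"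
      unfolding c_def by (rule ex_powr_dist_le_shell_cost) (rule assms fin W0 W)+
    then obtain m where "\<bar>X \<omega> - Y \<omega>\<bar> powr p \<le> c m \<omega>" ..
    then have "ennreal (\<bar>X \<omega> - Y \<omega>\<bar> powr p) \<le> ennreal (c m \<omega>)"
      by (rule ennreal_leI)
    also have "\<dots> = (\<Sum>m\<in>{m}. ennreal (c m \<omega>))" by simp
    also have "\<dots> \<le> (\<Sum>m. ennreal (c m \<omega>))"
      by (rule sum_le_suminf) auto
    finally show "ennreal (\<bar>X \<omega> - Y \<omega>\<bar> powr p) \<le> (\<Sum>m. ennreal (c m \<omega>))" .
  qed
  also have "\<dots> = (\<Sum>m. \<integral>\<^sup>+ \<omega>. ennreal (c m \<omega>) \<partial>\<Omega>)"
    using int by (intro nn_integral_suminf measurable_compose[OF _ measurable_ennreal])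
      (auto simp: has_bochner_integral_iff)
  also have "(\<lambda>m. \<integral>\<^sup>+ \<omega>. ennreal (c m \<omega>) \<partial>\<Omega>) = (\<lambda>m. ennreal (e m))"
  proof
    fix m show "(\<integral>\<^sup>+ \<omega>. ennreal (c m \<omega>) \<partial>\<Omega>) = ennreal (e m)"
      using int[of m] c by (subst nn_integral_eq_integral) (auto simp: has_bochner_integral_iff)
  qed
  also have "(\<Sum>m. ennreal (e m)) \<le> ennreal B"
  proof (rule suminf_le_const[OF summableI])
    fix N show "(\<Sum>m<N. ennreal (e m)) \<le> ennreal B"
      using B[of N] e by (subst sum_ennreal) (auto simp: sum_distrib_left e_def intro!: ennreal_leI)
  qed
  finally have "(\<integral>\<^sup>+ \<omega>. ennreal (\<bar>X \<omega> - Y \<omega>\<bar> powr p) \<partial>\<Omega>) \<le> ennreal B" .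
  moreover have "0 \<le> B" using B[of 0] by simp
  ultimately show ?thesis
    using wasserstein_powr_le[OF *(1-5)] \<open>1 \<le> p\<close> by simp
qed

subsection \<open>Distribution functions at grid points\<close>

lemma dyadic_scale_vimage_Ioc: "dyadic_scale m -` {a<..b} = {2 ^ m * a<..2 ^ m * b}"
  by (auto simp: dyadic_scale_def field_simps)

lemma dyadic_cell_in_partition:
  "k < 2 ^ l \<Longrightarrow> {-1 + real k * (2 / 2 ^ l)<..-1 + (real k + 1) * (2 / 2 ^ l)} \<in> dyadic_partition l"
  unfolding dyadic_partition_def
  by (rule CollectI, rule exI[of _ k]) (simp add: powr_diff powr_realpow)

text \<open>In the application \<open>r = (2 + \<alpha>) powr (- p)\<close>, \<open>q = 2 powr (- (2 * p + \<delta>))\<close>, and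
  \<open>e\<close> is the dependence of the cell bound on the level of the partition.\<close>

locale dyadic_discrepancy =
  fixes P Q :: "real measure" and M L :: nat and K r q \<epsilon> :: real and e :: "nat \<Rightarrow> real"
  assumes prob: "prob_on_real P" "prob_on_real Q"
    and L: "0 < L"
    and K: "0 \<le> K" and \<epsilon>: "0 \<le> \<epsilon>"
    and r: "0 \<le> r" "2 * r \<le> 1"
    and q: "0 \<le> q" "2 * q \<le> 1"
    and e: "\<And>l. 0 \<le> e l" "\<And>l. e l \<le> 1" "e 0 = 1"
    and shell: "\<And>m. measure P (dyadic_shell m) + measure Q (dyadic_shell m) \<le> K * q ^ m"
    and cell: "\<And>m l F. m \<le> M \<Longrightarrow> l \<le> L \<Longrightarrow> F \<in> dyadic_partition l \<Longrightarrow>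
                 cell_discrepancy P Q m F \<le> K * r ^ m * \<epsilon> * e l"
begin

sublocale P: real_distribution P
  using prob_on_real_cdf_distribution[OF prob(1)] by (simp add: cdf_distribution_def)

sublocale Q: real_distribution Q
  using prob_on_real_cdf_distribution[OF prob(2)] by (simp add: cdf_distribution_def)

definition H :: "real \<Rightarrow> real" where
  "H t = cdf P t - cdf Q t"

text \<open>Signed, unlike \<open>cell_discrepancy\<close>, so that it is additive over adjacent
  intervals.\<close>

definition D :: "nat \<Rightarrow> real set \<Rightarrow> real" where
  "D m F = measure P (dyadic_scale m -` F \<inter> dyadic_shell m)
             - measure Q (dyadic_scale m -` F \<inter> dyadic_shell m)"

text \<open>The total weight of a decomposition that uses one cell of each level up to
  \<open>l\<close>.\<close>

definition a :: "nat \<Rightarrow> real" where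
  "a l = (\<Sum>j\<le>l. e j)"

text \<open>A bound for \<open>H\<close> at the points of modulus \<open>2 ^ m\<close>: it dominates
  the geometric sums of the half-shell discrepancies beyond \<open>m\<close>, controlled by cells up
  to shell \<open>M\<close> and by mass alone afterwards.\<close>

definition V :: "nat \<Rightarrow> real" where
  "V m = (if m \<le> M then K * \<epsilon> * r ^ m else 0) + K * q ^ max m M"

lemma a_ge_1: "1 \<le> a l"
proof -
  have "(\<Sum>j\<in>{0}. e j) \<le> a l"
    unfolding a_def by (rule sum_mono2) (use e in auto)
  then show ?thesis using e by simp
qed

lemma H_diff: "s \<le> t \<Longrightarrow> H t - H s = measure P {s<..t} - measure Q {s<..t}"
  by (cases "s = t") (simp_all add: H_def P.cdf_diff_eq[symmetric] Q.cdf_diff_eq[symmetric])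

lemma D_Ioc_split:
  assumes "s \<le> t" "t \<le> u"
  shows "D m {s<..u} = D m {s<..t} + D m {t<..u}"
proof -
  have *: "dyadic_scale m -` {s<..u} \<inter> dyadic_shell m =
      (dyadic_scale m -` {s<..t} \<inter> dyadic_shell m) \<union> (dyadic_scale m -` {t<..u} \<inter> dyadic_shell m)"
    using assms by auto
  have sets: "dyadic_scale m -` {s<..t} \<inter> dyadic_shell m \<in> sets borel" for s t
    by (simp add: dyadic_scale_vimage_Ioc)
  have disj: "(dyadic_scale m -` {s<..t} \<inter> dyadic_shell m) \<inter> (dyadic_scale m -` {t<..u} \<inter> dyadic_shell m) = {}"
    by auto
  show ?thesis
    unfolding D_def * using sets disj
    by (simp add: P.finite_measure_Union Q.finite_measure_Union)
qed

lemma abs_D_le: "m \<le> M \<Longrightarrow> l \<le> L \<Longrightarrow> F \<in> dyadic_partition l \<Longrightarrow> \<bar>D m F\<bar> \<le> K * r ^ m * \<epsilon> * e l"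
  using cell by (simp add: D_def cell_discrepancy_def)

text \<open>Up to shell \<open>M\<close>, a half-shell is a single cell of level 1, a level
  available because \<open>0 < L\<close>. Further out, the difference of two nonnegative masses is
  at most the mass of the shell.\<close>

lemma abs_half_shell_le:
  assumes "I = dyadic_scale m -` F \<inter> dyadic_shell m" and "F \<in> dyadic_partition 1"
    and "I \<in> sets borel"
  shows "\<bar>measure P I - measure Q I\<bar> \<le> (if m \<le> M then K * \<epsilon> * r ^ m else K * q ^ m)"
proof (cases "m \<le> M")
  case True
  have "\<bar>D m F\<bar> \<le> K * r ^ m * \<epsilon> * e 1"
    by (rule abs_D_le) (use assms True L in auto)
  also have "\<dots> \<le> K * r ^ m * \<epsilon> * 1"
    using e(2) K r \<epsilon> by (intro mult_left_mono) auto
  finally show ?thesis using True by (simp add: D_def assms(1) mult_ac)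
next
  case False
  have "measure P I \<le> measure P (dyadic_shell m)" "measure Q I \<le> measure Q (dyadic_shell m)"
    using assms(1) by (auto intro!: P.finite_measure_mono Q.finite_measure_mono)
  moreover have "0 \<le> measure P I" "0 \<le> measure Q I" by simp_all
  ultimately have "\<bar>measure P I - measure Q I\<bar> \<le> K * q ^ m" using shell[of m] by linarith
  then show ?thesis using False by simp
qed

text \<open>Since \<open>2 * r \<le> 1\<close> and \<open>2 * q \<le> 1\<close>, each geometric term
  is at least twice the next one. In the passage from \<open>M\<close> to \<open>Suc M\<close>, the
  term \<open>K * q ^ M\<close> of \<open>V M\<close> alone suffices.\<close>

lemma V_step: "(if Suc m \<le> M then K * \<epsilon> * r ^ Suc m else K * q ^ Suc m) + V (Suc m) \<le> V m"
proof (cases "Suc m \<le> M")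
  case True
  have "(K * \<epsilon> * r ^ m) * (2 * r) \<le> (K * \<epsilon> * r ^ m) * 1"
    using K r \<epsilon> by (intro mult_left_mono) auto
  then have "2 * (K * \<epsilon> * r ^ Suc m) \<le> K * \<epsilon> * r ^ m" by (simp add: mult_ac)
  then show ?thesis using True by (simp add: V_def max_def del: power_Suc)
next
  case False
  have "(K * q ^ m) * (2 * q) \<le> (K * q ^ m) * 1"
    using K q by (intro mult_left_mono) auto
  then have "2 * (K * q ^ Suc m) \<le> K * q ^ m" by (simp add: mult_ac)
  moreover have "K * q ^ m \<le> V m"
    using False K r \<epsilon> by (cases "m = M") (auto simp: V_def max_def)
  moreover have "V (Suc m) = K * q ^ Suc m"
    using False by (simp add: V_def max_def)
  ultimately show ?thesis using False by simp
qed

lemma V_nonneg: "0 \<le> V m"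
  using K r q \<epsilon> by (auto simp: V_def)

text \<open>By \<open>V_step\<close>, each increment of \<open>H\<close> is at most the decrease of
  \<open>V\<close>. The increments telescope, and the remaining value of \<open>H\<close> vanishes
  in the limit.\<close>

lemma H_telescope:
  fixes s :: "nat \<Rightarrow> real"
  assumes step: "\<And>m. \<bar>H (s m) - H (s (Suc m))\<bar> \<le> (if Suc m \<le> M then K * \<epsilon> * r ^ Suc m else K * q ^ Suc m)"
    and lim: "(\<lambda>m. H (s m)) \<longlonglongrightarrow> 0"
  shows "\<bar>H (s m)\<bar> \<le> V m"
proof -
  have "\<bar>H (s m)\<bar> \<le> V m + \<bar>H (s (m + n))\<bar>" for n
  proof -
    have "\<bar>H (s m)\<bar> \<le> V m - V (m + n) + \<bar>H (s (m + n))\<bar>"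
    proof (induction n)
      case (Suc n)
      then show ?case using step[of "m + n"] V_step[of "m + n"] by (simp del: power_Suc)
    qed simp
    then show ?thesis using V_nonneg[of "m + n"] by linarith
  qed
  moreover have "(\<lambda>n. V m + \<bar>H (s (m + n))\<bar>) \<longlonglongrightarrow> V m + \<bar>0\<bar>"
    using LIMSEQ_ignore_initial_segment[OF lim, of m] by (intro tendsto_intros) (simp add: add.commute)
  ultimately show ?thesis
    using LIMSEQ_le_const[of "\<lambda>n. V m + \<bar>H (s (m + n))\<bar>" "V m" "\<bar>H (s m)\<bar>"] by auto
qed

lemma filterlim_power2_at_top: "filterlim (\<lambda>m. 2 ^ m :: real) at_top sequentially"
  by (rule filterlim_at_top_mono[OF filterlim_real_sequentially])
    (auto simp: of_nat_less_two_power less_imp_le)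

lemma abs_H_power_le: "\<bar>H (2 ^ m)\<bar> \<le> V m"
proof (rule H_telescope)
  fix m
  have "{2 ^ m<..2 ^ Suc m} = dyadic_scale (Suc m) -` {0<..1} \<inter> dyadic_shell (Suc m)"
    by (auto simp: dyadic_scale_vimage_Ioc dyadic_shell_def intro: less_trans[OF _ zero_less_power] dest: less_le_trans[of 0])
  moreover have "{0<..1::real} \<in> dyadic_partition 1"
    using dyadic_cell_in_partition[of 1 1] by simp
  ultimately have "\<bar>measure P {2 ^ m<..2 ^ Suc m} - measure Q {2 ^ m<..2 ^ Suc m}\<bar>
     \<le> (if Suc m \<le> M then K * \<epsilon> * r ^ Suc m else K * q ^ Suc m)"
    by (rule abs_half_shell_le) simp
  then show "\<bar>H (2 ^ m) - H (2 ^ Suc m)\<bar> \<le> (if Suc m \<le> M then K * \<epsilon> * r ^ Suc m else K * q ^ Suc m)"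
    using H_diff[of "2 ^ m" "2 ^ Suc m"] by (simp add: abs_minus_commute)
next
  have "(H \<longlongrightarrow> 1 - 1) at_top"
    unfolding H_def by (intro tendsto_diff P.cdf_lim_at_top_prob Q.cdf_lim_at_top_prob)
  then show "(\<lambda>m. H (2 ^ m)) \<longlonglongrightarrow> 0"
    by (auto intro: filterlim_compose filterlim_power2_at_top)
qed

lemma abs_H_uminus_power_le: "\<bar>H (- (2 ^ m))\<bar> \<le> V m"
proof (rule H_telescope)
  fix m
  have "{- (2 ^ Suc m)<..- (2 ^ m)} = dyadic_scale (Suc m) -` {-1<..0} \<inter> dyadic_shell (Suc m)"
    using zero_less_power[of "2::real" m]
    by (auto simp: dyadic_scale_vimage_Ioc dyadic_shell_def simp del: zero_less_power)
  moreover have "{-1<..0::real} \<in> dyadic_partition 1"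
    using dyadic_cell_in_partition[of 0 1] by simp
  ultimately have "\<bar>measure P {- (2 ^ Suc m)<..- (2 ^ m)} - measure Q {- (2 ^ Suc m)<..- (2 ^ m)}\<bar>
     \<le> (if Suc m \<le> M then K * \<epsilon> * r ^ Suc m else K * q ^ Suc m)"
    by (rule abs_half_shell_le) simp
  then show "\<bar>H (- (2 ^ m)) - H (- (2 ^ Suc m))\<bar> \<le> (if Suc m \<le> M then K * \<epsilon> * r ^ Suc m else K * q ^ Suc m)"
    using H_diff[of "- (2 ^ Suc m)" "- (2 ^ m)"] by simp
next
  have "(H \<longlongrightarrow> 0 - 0) at_bot"
    unfolding H_def by (intro tendsto_diff P.cdf_lim_at_bot Q.cdf_lim_at_bot)
  moreover have "filterlim (\<lambda>m. - (2 ^ m) :: real) at_bot sequentially"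
    by (simp add: filterlim_uminus_at_bot filterlim_power2_at_top)
  ultimately show "(\<lambda>m. H (- (2 ^ m))) \<longlonglongrightarrow> 0"
    by (auto intro: filterlim_compose)
qed

text \<open>Binary expansion of the end point: an even index already belongs to the previous level,
  and an odd one does so after one cell of the current level is split off. Thus at most one cell of
  each level is used.\<close>

lemma abs_D_suffix_le:
  assumes "m \<le> M"
  shows "l \<le> L \<Longrightarrow> k \<le> 2 ^ l \<Longrightarrow> \<bar>D m {-1 + real k * (2 / 2 ^ l)<..1}\<bar> \<le> K * r ^ m * \<epsilon> * a l"
proof (induction l arbitrary: k)
  case 0
  have c: "0 \<le> K * r ^ m * \<epsilon>" using K r \<epsilon> by simp
  consider "k = 0" | "k = 1" using 0 by fastforce
  then show ?case
  proof cases
    case 1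
    then show ?thesis
      using abs_D_le[OF assms, of 0 "{-1<..1}"] dyadic_cell_in_partition[of 0 0] by (simp add: a_def)
  next
    case 2
    then have "D m {-1 + real k * (2 / 2 ^ 0)<..1} = 0" by (simp add: D_def)
    then show ?thesis using c a_ge_1[of 0] by simp
  qed
next
  case (Suc l)
  have c: "0 \<le> K * r ^ m * \<epsilon>" using K r \<epsilon> by simp
  have a_Suc: "a (Suc l) = a l + e (Suc l)" by (simp add: a_def)
  have even: "\<bar>D m {-1 + real (2 * j) * (2 / 2 ^ Suc l)<..1}\<bar> \<le> K * r ^ m * \<epsilon> * a l" if "j \<le> 2 ^ l" for j
  proof -
    have *: "-1 + real (2 * j) * (2 / 2 ^ Suc l) = -1 + real j * (2 / 2 ^ l)" by simp
    show ?thesis unfolding * by (rule Suc.IH) (use that Suc.prems in auto)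
  qed
  show ?case
  proof (cases "even k")
    case True
    then obtain j where "k = 2 * j" by blast
    moreover have "K * r ^ m * \<epsilon> * a l \<le> K * r ^ m * \<epsilon> * a (Suc l)"
      using c e by (intro mult_left_mono) (auto simp: a_Suc)
    ultimately show ?thesis using even[of j] Suc.prems by simp
  next
    case False
    then obtain j where k: "k = 2 * j + 1" by (rule oddE)
    define s t where "s = -1 + real k * (2 / 2 ^ Suc l)" and "t = -1 + (real k + 1) * (2 / 2 ^ Suc l)"
    \<comment> \<open>An odd index cannot equal the even bound \<open>2 ^ Suc l\<close>, so cell
      \<open>k\<close> exists.\<close>
    have "k + 1 \<le> 2 ^ Suc l" using Suc.prems k by (simp, presburger)
    then have j: "j + 1 \<le> 2 ^ l" using k by simp
    have t: "t = -1 + real (2 * (j + 1)) * (2 / 2 ^ Suc l)" by (simp add: t_def k)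
    have "real (2 * (j + 1)) \<le> 2 ^ Suc l"
      using j by (metis mult_le_mono2 of_nat_le_iff of_nat_numeral of_nat_power power_Suc)
    then have "t \<le> 1" unfolding t by (simp add: field_simps)
    moreover have "s \<le> t" by (simp add: s_def t_def divide_right_mono)
    ultimately have "D m {s<..1} = D m {s<..t} + D m {t<..1}" by (intro D_Ioc_split)
    moreover have "\<bar>D m {s<..t}\<bar> \<le> K * r ^ m * \<epsilon> * e (Suc l)"
      using abs_D_le[OF assms \<open>Suc l \<le> L\<close>] dyadic_cell_in_partition[of k "Suc l"] \<open>k + 1 \<le> 2 ^ Suc l\<close>
      by (simp add: s_def t_def)
    moreover have "\<bar>D m {t<..1}\<bar> \<le> K * r ^ m * \<epsilon> * a l"
      using even[OF j] unfolding t .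
    ultimately have "\<bar>D m {s<..1}\<bar> \<le> K * r ^ m * \<epsilon> * a (Suc l)"
      by (simp add: a_Suc distrib_left)
    then show ?thesis by (simp add: s_def)
  qed
qed

text \<open>On the right half, the interval from the grid point to \<open>2 ^ m\<close> lies in the
  shell and is a suffix. On the left half, the interval from \<open>- (2 ^ m)\<close> to the grid
  point is the whole shell minus a suffix, which gives the factor 2.\<close>

lemma abs_H_grid_le:
  assumes m: "m \<le> M" and l: "l \<le> L" and k: "k \<in> grid_indices m l"
  shows "\<bar>H (grid m l k)\<bar> \<le> V m + 2 * (K * r ^ m * \<epsilon> * a l)"
proof -
  define s where "s = -1 + real k * (2 / 2 ^ l)"
  have t: "grid m l k = 2 ^ m * s" by (simp add: grid_eq s_def algebra_simps)
  have k': "k \<le> 2 ^ l" using k by (simp add: grid_indices_def)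
  then have "real k \<le> 2 ^ l" by (metis of_nat_le_iff of_nat_numeral of_nat_power)
  then have s: "-1 \<le> s" "s \<le> 1" by (simp_all add: s_def field_simps)
  have suffix: "\<bar>D m {s<..1}\<bar> \<le> K * r ^ m * \<epsilon> * a l"
    unfolding s_def by (rule abs_D_suffix_le[OF m l k'])
  have total: "\<bar>D m {-1<..1}\<bar> \<le> K * r ^ m * \<epsilon> * a l"
    using abs_D_suffix_le[OF m l, of 0] by simp
  have "m = 0 \<or> 2 ^ (m - 1) \<le> 2 ^ m * s \<or> m \<noteq> 0 \<and> 2 ^ m * s \<le> - (2 ^ (m - 1))"
    using k by (auto simp: grid_indices_def t)
  then consider "m = 0 \<or> 2 ^ (m - 1) \<le> 2 ^ m * s" | "m \<noteq> 0" "2 ^ m * s \<le> - (2 ^ (m - 1))" by blast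
  then show ?thesis
  proof cases
    case 1
    have p: "2 ^ (m - 1) > (0::real)" by simp
    have "dyadic_scale m -` {s<..1} \<inter> dyadic_shell m = {2 ^ m * s<..2 ^ m}"
      unfolding dyadic_scale_vimage_Ioc dyadic_shell_def using 1 s p
      by (auto split: if_splits simp del: zero_less_power)
    then have "H (2 ^ m) - H (2 ^ m * s) = D m {s<..1}"
      using s by (simp add: H_diff D_def)
    then show ?thesis using suffix abs_H_power_le[of m] unfolding t by linarith
  next
    case 2
    then obtain j where j: "m = Suc j" by (cases m) auto
    have "{- (2 * c)<..u} \<inter> ({- (2 * c)<..2 * c} - {- c<..c}) = {- (2 * c)<..u}"
      if "0 < c" "u \<le> - c" for c u :: real
      using that by auto
    moreover have "dyadic_shell m = {- (2 * 2 ^ j)<..2 * 2 ^ j} - {- (2 ^ j)<..2 ^ j}"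
      by (simp add: dyadic_shell_def j)
    moreover have "(2::real) ^ m * -1 = - (2 * 2 ^ j)" by (simp add: j)
    then have "dyadic_scale m -` {-1<..s} = {- (2 * 2 ^ j)<..2 ^ m * s}"
      by (simp only: dyadic_scale_vimage_Ioc)
    moreover have "m - 1 = j" by (simp add: j)
    then have "2 ^ m * s \<le> - (2 ^ j)" using 2(2) by (simp only:)
    moreover have "0 < (2::real) ^ j" by simp
    ultimately have "dyadic_scale m -` {-1<..s} \<inter> dyadic_shell m = {- (2 * 2 ^ j)<..2 ^ m * s}"
      by metis
    moreover have "(2::real) ^ m = 2 * 2 ^ j" by (simp add: j)
    ultimately have "dyadic_scale m -` {-1<..s} \<inter> dyadic_shell m = {- (2 ^ m)<..2 ^ m * s}"
      by metis
    moreover have "- (2 ^ m) \<le> 2 ^ m * s" using mult_left_mono[OF s(1), of "2 ^ m"] by simp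
    ultimately have "H (2 ^ m * s) - H (- (2 ^ m)) = D m {-1<..s}"
      unfolding D_def by (metis H_diff)
    moreover have "D m {-1<..1} = D m {-1<..s} + D m {s<..1}"
      using s by (rule D_Ioc_split)
    ultimately show ?thesis using suffix total abs_H_uminus_power_le[of m] unfolding t by linarith
  qed
qed

end

subsection \<open>Summation over the shells\<close>

lemma sum_geometric_le:
  fixes x :: real
  assumes "0 \<le> x" "x < 1"
  shows "(\<Sum>m<N. x ^ m) \<le> 1 / (1 - x)"
  using assms by (simp add: sum_gp_strict divide_right_mono)

text \<open>For a base of at least 2, each power dominates the sum of all smaller ones.\<close>

lemma sum_truncated_powers_le:
  fixes b :: real
  assumes "2 \<le> b"
  shows "(\<Sum>m<N. if m \<le> M then b ^ m else 0) \<le> b ^ min N (Suc M)"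
proof (induction N)
  case (Suc N)
  have "2 * b ^ N \<le> b ^ Suc N" using assms by simp
  with Suc show ?case
    by (cases "N \<le> M") (auto simp: min_def not_less_eq_eq le_Suc_eq simp del: power_Suc split: if_splits)
qed simp

text \<open>The subtracted term makes the induction work: one step frees
  \<open>2 * x ^ N - 2 * x ^ Suc N\<close>, which is at least \<open>x ^ N\<close>.\<close>

lemma sum_tail_powers_le:
  fixes x :: real
  assumes "0 \<le> x" "2 * x \<le> 1"
  shows "(\<Sum>m<N. if m \<le> M then 0 else x ^ m) \<le> 2 * x ^ M - 2 * x ^ max M N"
proof (induction N)
  case (Suc N)
  have step: "2 * x ^ Suc N \<le> x ^ N"
    using mult_right_mono[OF assms(2), of "x ^ N"] assms(1) by simp
  show ?case
  proof (cases "N < M")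
    case True
    then have "max M N = M" "max M (Suc N) = M" by auto
    then show ?thesis using Suc True by simp
  next
    case False
    then have "max M N = N" "max M (Suc N) = Suc N" by auto
    moreover have "0 \<le> x ^ N" using assms by simp
    ultimately show ?thesis using Suc step False by (auto simp del: power_Suc)
  qed
qed simp

context dyadic_discrepancy
begin

lemma grid_discrepancy_le:
  assumes "\<And>k. k \<in> grid_indices m l \<Longrightarrow> \<bar>H (grid m l k)\<bar> \<le> B" and "0 \<le> B"
  shows "grid_discrepancy P Q m l \<le> 2 * 2 ^ l * B"
proof -
  have "card (grid_indices m l) \<le> card {..2 ^ l :: nat}"
    by (rule card_mono) (auto simp: grid_indices_def)
  also have "\<dots> \<le> 2 * 2 ^ l" by simp
  finally have card: "real (card (grid_indices m l)) \<le> 2 * 2 ^ l"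
    by (metis of_nat_le_iff of_nat_mult of_nat_numeral of_nat_power)
  have "grid_discrepancy P Q m l \<le> (\<Sum>k\<in>grid_indices m l. B)"
    unfolding grid_discrepancy_def by (rule sum_mono) (use assms(1) in \<open>simp add: H_def\<close>)
  also have "\<dots> \<le> 2 * 2 ^ l * B"
    using card assms(2) by (simp add: mult_right_mono)
  finally show ?thesis .
qed

text \<open>A level has at most \<open>2 * 2 ^ l\<close> grid points, which turns its weight
  \<open>2 powr (- real l * p)\<close> into \<open>2 powr (real l * (1 - p))\<close>. What remains
  of the dependence on the level is \<open>a l\<close>, and \<open>S\<close> bounds the resulting
  sum.\<close>

lemma expected_shell_cost_inner_le:
  assumes m: "m \<le> M" and W: "W \<subseteq> {..L}"
    and S: "(\<Sum>l\<in>W. 2 powr (real l * (1 - p)) * a l) \<le> S"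
  shows "expected_shell_cost P Q p L W m \<le>
    2 powr (real m * p) * (2 powr (- real L * p) * (K * q ^ m) + 2 * S * (3 * K * \<epsilon> * r ^ m + K * q ^ M))"
proof -
  define Z where "Z = 3 * K * \<epsilon> * r ^ m + K * q ^ M"
  have Z: "0 \<le> Z" unfolding Z_def using K \<epsilon> r q by simp
  have "(\<Sum>l\<in>W. 2 powr (- real l * p) * grid_discrepancy P Q m l)
      \<le> (\<Sum>l\<in>W. 2 * Z * (2 powr (real l * (1 - p)) * a l))"
  proof (rule sum_mono)
    fix l assume "l \<in> W"
    then have l: "l \<le> L" using W by auto
    have "grid_discrepancy P Q m l \<le> 2 * 2 ^ l * (a l * Z)"
    proof (rule grid_discrepancy_le)
      fix k assume "k \<in> grid_indices m l"
      from abs_H_grid_le[OF m l this]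
      have "\<bar>H (grid m l k)\<bar> \<le> 1 * (K * \<epsilon> * r ^ m + K * q ^ M) + 2 * (K * r ^ m * \<epsilon> * a l)"
        using m by (simp add: V_def max_def)
      \<comment> \<open>Since \<open>1 \<le> a l\<close>, the boundary term can carry this factor
        too; the constant 3 in \<open>Z\<close> is 1 from \<open>V m\<close> and 2 from the
        cells.\<close>
      also have "\<dots> \<le> a l * (K * \<epsilon> * r ^ m + K * q ^ M) + 2 * (K * r ^ m * \<epsilon> * a l)"
        using a_ge_1[of l] K \<epsilon> r q by (intro add_right_mono mult_right_mono) auto
      also have "\<dots> = a l * Z" by (simp add: Z_def algebra_simps)
      finally show "\<bar>H (grid m l k)\<bar> \<le> a l * Z" .
    next
      show "0 \<le> a l * Z" using a_ge_1[of l] Z by simp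
    qed
    then have "2 powr (- real l * p) * grid_discrepancy P Q m l
        \<le> 2 powr (- real l * p) * (2 * 2 ^ l * (a l * Z))"
      by (rule mult_left_mono) simp
    also have "\<dots> = 2 * Z * ((2 powr (- real l * p) * 2 ^ l) * a l)" by (simp only: mult_ac)
    also have "2 powr (- real l * p) * 2 ^ l = 2 powr (real l * (1 - p))"
      by (simp add: powr_add[symmetric] algebra_simps flip: powr_realpow)
    finally show "2 powr (- real l * p) * grid_discrepancy P Q m l
        \<le> 2 * Z * (2 powr (real l * (1 - p)) * a l)" .
  qed
  also have "\<dots> \<le> 2 * Z * S"
    unfolding sum_distrib_left[symmetric] using S Z by (intro mult_left_mono) auto
  finally have "(\<Sum>l\<in>W. 2 powr (- real l * p) * grid_discrepancy P Q m l) \<le> 2 * S * Z"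
    by (simp add: mult_ac)
  then show ?thesis
    unfolding expected_shell_cost_def Z_def[symmetric]
    using shell[of m] by (intro mult_left_mono add_mono) auto
qed

text \<open>Only the end points of the shell count here. The constant 3 is 1 from the mass of the
  shell and 2 from these points.\<close>

lemma expected_shell_cost_outer_le:
  assumes m: "M < m"
  shows "expected_shell_cost P Q p 0 {0} m \<le> 2 powr (real m * p) * (3 * K * q ^ m)"
proof -
  have "grid_discrepancy P Q m 0 \<le> 2 * 2 ^ 0 * (K * q ^ m)"
  proof (rule grid_discrepancy_le)
    fix k assume "k \<in> grid_indices m 0"
    then have "grid m 0 k = 2 ^ m \<or> grid m 0 k = - (2 ^ m)"
      using grid_level_0[of m] by (auto simp: grid_indices_level_0)
    moreover have "V m = K * q ^ m" using m by (simp add: V_def max_def)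
    ultimately show "\<bar>H (grid m 0 k)\<bar> \<le> K * q ^ m"
      using abs_H_power_le[of m] abs_H_uminus_power_le[of m] by auto
  qed (use K q in auto)
  then show ?thesis
    unfolding expected_shell_cost_def using shell[of m] by (intro mult_left_mono) auto
qed

text \<open>Weighted by \<open>2 powr (real m * p)\<close>, the mass and cell bounds are summable by
  \<open>bq\<close> and \<open>br\<close>. The boundary error \<open>K * q ^ M\<close> is constant
  in \<open>m\<close>, but its weights grow geometrically, so that the last shell \<open>M\<close>
  dominates.\<close>

lemma wasserstein_powr_bound:
  assumes p: "1 \<le> p" and W: "W \<subseteq> {..L}" "0 \<in> W" "W = {..L} \<or> p = 1 \<and> L \<in> W"
    and S: "(\<Sum>l\<in>W. 2 powr (real l * (1 - p)) * a l) \<le> S"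
    and br: "2 powr p * r < 1" and bq: "2 powr p * (2 powr p * q) \<le> 1"
  shows "ennreal_powr (wasserstein p P Q) p \<le> ennreal
    (4 powr p * K * (8 + 6 * S / (1 - 2 powr p * r) + 2 * S * 2 powr p)
      * (2 powr (- real L * p) + \<epsilon> + (2 powr p * q) ^ M))"
proof -
  define b where "b = 2 powr p"
  define x where "x = b * q"
  define c where "c = 1 / (1 - b * r)"
  define T where "T = 2 powr (- real L * p)"
  define Lm where "Lm m = (if m \<le> M then L else 0)" for m
  define Wm where "Wm m = (if m \<le> M then W else {0})" for m
  let ?cost = "\<lambda>m. expected_shell_cost P Q p (Lm m) (Wm m) m"
  have b: "2 \<le> b" using powr_mono[of 1 p 2] p by (simp add: b_def)
  have bm: "2 powr (real m * p) = b ^ m" for m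
    by (simp add: b_def powr_powr mult.commute flip: powr_realpow)
  have x: "0 \<le> x" "2 * x \<le> 1"
  proof -
    show "0 \<le> x" using b q by (simp add: x_def)
    then have "2 * x \<le> b * x" using b by (intro mult_right_mono) auto
    then show "2 * x \<le> 1" using bq unfolding x_def b_def by linarith
  qed
  have c: "0 \<le> c" using br by (simp add: c_def b_def)
  have T: "0 \<le> T" by (simp add: T_def)
  have S0: "0 \<le> S"
  proof -
    have "0 \<le> (\<Sum>l\<in>W. 2 powr (real l * (1 - p)) * a l)"
      using a_ge_1 by (intro sum_nonneg mult_nonneg_nonneg) (auto intro: order_trans[OF zero_le_one])
    then show ?thesis using S by simp
  qed
  have cost: "?cost m \<le> K * T * (1 / 2) ^ m + 6 * S * K * \<epsilon> * (b * r) ^ m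
      + (2 * S * K * q ^ M * (if m \<le> M then b ^ m else 0) + 3 * K * (if m \<le> M then 0 else x ^ m))"
    for m
  proof (cases "m \<le> M")
    case True
    have "?cost m \<le> b ^ m * (T * (K * q ^ m) + 2 * S * (3 * K * \<epsilon> * r ^ m + K * q ^ M))"
      using expected_shell_cost_inner_le[OF True W(1) S] True by (simp add: Lm_def Wm_def bm T_def)
    also have "\<dots> = K * T * x ^ m + 6 * S * K * \<epsilon> * (b * r) ^ m + 2 * S * K * q ^ M * b ^ m"
      by (simp add: x_def power_mult_distrib algebra_simps)
    also have "x ^ m \<le> (1 / 2) ^ m" by (rule power_mono) (use x in auto)
    then have "K * T * x ^ m + 6 * S * K * \<epsilon> * (b * r) ^ m + 2 * S * K * q ^ M * b ^ m
       \<le> K * T * (1 / 2) ^ m + 6 * S * K * \<epsilon> * (b * r) ^ m + 2 * S * K * q ^ M * b ^ m"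
      using K T by (intro add_right_mono mult_left_mono) auto
    finally show ?thesis using True by simp
  next
    case False
    have "?cost m \<le> b ^ m * (3 * K * q ^ m)"
      using expected_shell_cost_outer_le[of m p] False by (simp add: Lm_def Wm_def bm)
    also have "\<dots> = 3 * K * x ^ m" by (simp add: x_def power_mult_distrib)
    also have "\<dots> \<le> K * T * (1 / 2) ^ m + 6 * S * K * \<epsilon> * (b * r) ^ m + 3 * K * x ^ m"
      using K T S0 \<epsilon> b r by simp
    finally show ?thesis using False by simp
  qed
  have bound: "4 powr p * (\<Sum>m<N. ?cost m) \<le> 4 powr p * (K * (8 + 6 * S * c + 2 * S * b) * (T + \<epsilon> + x ^ M))" for N
  proof (rule mult_left_mono)
    have "(\<Sum>m<N. ?cost m) \<le> (\<Sum>m<N. K * T * (1 / 2) ^ m + 6 * S * K * \<epsilon> * (b * r) ^ m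
      + (2 * S * K * q ^ M * (if m \<le> M then b ^ m else 0) + 3 * K * (if m \<le> M then 0 else x ^ m)))"
      by (rule sum_mono) (rule cost)
    also have "\<dots> = K * T * (\<Sum>m<N. (1 / 2) ^ m) + 6 * S * K * \<epsilon> * (\<Sum>m<N. (b * r) ^ m)
      + (2 * S * K * q ^ M * (\<Sum>m<N. if m \<le> M then b ^ m else 0)
      + 3 * K * (\<Sum>m<N. if m \<le> M then 0 else x ^ m))"
      unfolding sum.distrib sum_distrib_left[symmetric] by (rule refl)
    also have "\<dots> \<le> K * T * 2 + 6 * S * K * \<epsilon> * c + (2 * S * K * q ^ M * b ^ Suc M + 3 * K * (2 * x ^ M))"
    proof (intro add_mono mult_left_mono)
      show "(\<Sum>m<N. (1 / 2) ^ m) \<le> (2::real)" using sum_geometric_le[of "1/2" N] by simp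
      show "(\<Sum>m<N. (b * r) ^ m) \<le> c" unfolding c_def
        by (rule sum_geometric_le) (use b r br in \<open>auto simp: b_def\<close>)
      have "(\<Sum>m<N. if m \<le> M then b ^ m else 0) \<le> b ^ min N (Suc M)"
        by (rule sum_truncated_powers_le) (rule b)
      also have "\<dots> \<le> b ^ Suc M" by (rule power_increasing) (use b in auto)
      finally show "(\<Sum>m<N. if m \<le> M then b ^ m else 0) \<le> b ^ Suc M" .
      have "0 \<le> x ^ max M N" using x by simp
      with sum_tail_powers_le[OF x, of M N]
      show "(\<Sum>m<N. if m \<le> M then 0 else x ^ m) \<le> 2 * x ^ M" by linarith
    qed (use K T S0 \<epsilon> q in auto)
    also have "\<dots> = K * (2 * T + (6 * S * c) * \<epsilon> + (2 * S * b + 6) * x ^ M)"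
      by (simp add: x_def power_mult_distrib algebra_simps)
    \<comment> \<open>The common coefficient dominates all three; 8 covers the constants 2 and
      6.\<close>
    also have "\<dots> \<le> K * ((8 + 6 * S * c + 2 * S * b) * T + (8 + 6 * S * c + 2 * S * b) * \<epsilon>
        + (8 + 6 * S * c + 2 * S * b) * x ^ M)"
    proof (rule mult_left_mono[OF _ K], rule add_mono[OF add_mono]; rule mult_right_mono)
      have "0 \<le> S * c" "0 \<le> S * b" using S0 b c by auto
      then show "2 \<le> 8 + 6 * S * c + 2 * S * b" "6 * S * c \<le> 8 + 6 * S * c + 2 * S * b"
        "2 * S * b + 6 \<le> 8 + 6 * S * c + 2 * S * b" by auto
    qed (use T \<epsilon> x in auto)
    also have "\<dots> = K * (8 + 6 * S * c + 2 * S * b) * (T + \<epsilon> + x ^ M)"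
      by (simp add: algebra_simps)
    finally show "(\<Sum>m<N. ?cost m) \<le> K * (8 + 6 * S * c + 2 * S * b) * (T + \<epsilon> + x ^ M)" .
  qed simp
  have "ennreal_powr (wasserstein p P Q) p \<le>
      ennreal (4 powr p * (K * (8 + 6 * S * c + 2 * S * b) * (T + \<epsilon> + x ^ M)))"
  proof (rule wasserstein_powr_le_suminf[OF p prob _ _ _ bound])
    show "finite (Wm m)" for m using W(1) by (auto simp: Wm_def intro: finite_subset)
    show "0 \<in> Wm m" for m using W(2) by (simp add: Wm_def)
    show "{..Lm m} \<subseteq> Wm m \<or> p = 1 \<and> Lm m \<in> Wm m" for m using W(3) by (auto simp: Lm_def Wm_def)
  qed
  then show ?thesis by (simp add: b_def c_def T_def x_def mult.assoc)
qed

end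

section \<open>Specialization to the hypotheses of the theorem and uniformity of the
  constant\<close>

lemma dyadic_discrepancyI:
  fixes p \<alpha> K \<delta> \<epsilon> :: real
  assumes "1 \<le> p" "0 < \<alpha>" "0 < K" "prob_on_real P" "prob_on_real Q" "0 < L" "0 < \<delta>" "0 < \<epsilon>"
    and "\<And>l. 0 \<le> e l" "\<And>l. e l \<le> 1" "e 0 = 1"
    and shell: "\<forall>m. measure P (dyadic_shell m) + measure Q (dyadic_shell m)
               \<le> K * 2 powr (- (2 * p + \<delta>) * real m)"
    and cell: "\<forall>m\<le>M. \<forall>l\<le>L. \<forall>F\<in>dyadic_partition l.
           cell_discrepancy P Q m F \<le> K * (2 + \<alpha>) powr (- real m * p) * \<epsilon> * e l"
  shows "dyadic_discrepancy P Q M L K ((2 + \<alpha>) powr (- p)) (2 powr (- (2 * p + \<delta>))) \<epsilon> e"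
proof
  have "(2 + \<alpha>) powr (- p) \<le> (2 + \<alpha>) powr (- 1)"
    by (rule powr_mono) (use assms in auto)
  also have "\<dots> \<le> 1 / 2" using assms by (simp add: powr_minus_divide field_simps)
  finally show "2 * (2 + \<alpha>) powr (- p) \<le> 1" by simp
  have "2 powr (- (2 * p + \<delta>)) \<le> 2 powr (- 1)"
    by (rule powr_mono) (use assms in auto)
  then show "2 * 2 powr (- (2 * p + \<delta>)) \<le> 1" by (simp add: powr_minus_divide)
  fix m
  have "2 powr (- (2 * p + \<delta>) * real m) = (2 powr (- (2 * p + \<delta>))) ^ m"
    by (simp add: powr_powr flip: powr_realpow)
  then show "measure P (dyadic_shell m) + measure Q (dyadic_shell m) \<le> K * (2 powr (- (2 * p + \<delta>))) ^ m"
    using shell by metis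
  fix l F assume "m \<le> M" "l \<le> L" "F \<in> dyadic_partition l"
  moreover have "(2 + \<alpha>) powr (- real m * p) = ((2 + \<alpha>) powr (- p)) ^ m"
    using assms(2) by (simp add: powr_powr mult.commute flip: powr_realpow)
  ultimately show "cell_discrepancy P Q m F \<le> K * ((2 + \<alpha>) powr (- p)) ^ m * \<epsilon> * e l"
    using cell by metis
qed (use assms in auto)

text \<open>The constant is fixed before the measures, \<open>M\<close>, \<open>L\<close>,
  \<open>\<delta>\<close> and \<open>\<epsilon>\<close>. In particular \<open>\<delta>\<close>
  enters the summation only through \<open>2 powr (- \<delta>) \<le> 1\<close>.\<close>

lemma wasserstein_powr_bound_of_level_weights:
  fixes p \<alpha> K S :: real and e :: "nat \<Rightarrow> real" and W :: "nat \<Rightarrow> nat set"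
  assumes p: "1 \<le> p" and \<alpha>: "0 < \<alpha>" and K: "0 < K" and S: "0 \<le> S"
    and e: "\<And>l. 0 \<le> e l" "\<And>l. e l \<le> 1" "e 0 = 1"
    and W: "\<And>L. W L \<subseteq> {..L}" "\<And>L. 0 \<in> W L" "\<And>L. W L = {..L} \<or> p = 1 \<and> L \<in> W L"
    and sum: "\<And>L. (\<Sum>l\<in>W L. 2 powr (real l * (1 - p)) * (\<Sum>j\<le>l. e j)) \<le> S"
  shows "\<exists>K'>0. \<forall>P Q (M::nat) (L::nat) (\<delta>::real) (\<epsilon>::real).
        prob_on_real P \<longrightarrow> prob_on_real Q \<longrightarrow> 0 < M \<longrightarrow> 0 < L \<longrightarrow> 0 < \<delta> \<longrightarrow> 0 < \<epsilon> \<longrightarrow>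
        (\<forall>m. measure P (dyadic_shell m) + measure Q (dyadic_shell m)
               \<le> K * 2 powr (- (2 * p + \<delta>) * real m)) \<longrightarrow>
        (\<forall>m\<le>M. \<forall>l\<le>L. \<forall>F\<in>dyadic_partition l.
           cell_discrepancy P Q m F \<le> K * (2 + \<alpha>) powr (- real m * p) * \<epsilon> * e l) \<longrightarrow>
        ennreal_powr (wasserstein p P Q) p
          \<le> ennreal (K' * (2 powr (- real L * p) + \<epsilon> + 2 powr (- (p + \<delta>) * real M)))"
proof -
  define r where "r = (2 + \<alpha>) powr (- p)"
  define K' where "K' = 4 powr p * K * (8 + 6 * S / (1 - 2 powr p * r) + 2 * S * 2 powr p)"
  \<comment> \<open>This strict inequality is where \<open>0 < \<alpha>\<close> makes the sum of the
    cell errors over the shells converge.\<close>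
  have "2 powr p * r = (2 / (2 + \<alpha>)) powr p"
    using \<alpha> by (simp add: r_def powr_divide powr_minus_divide)
  also have "\<dots> < 1 powr p"
    by (rule powr_less_mono2) (use p \<alpha> in auto)
  finally have br: "2 powr p * r < 1" by simp
  have "0 < 8 + 6 * S / (1 - 2 powr p * r) + 2 * S * 2 powr p"
    using S br by (intro add_pos_nonneg) auto
  then have "0 < K'" using K by (simp add: K'_def)
  moreover have "ennreal_powr (wasserstein p P Q) p
          \<le> ennreal (K' * (2 powr (- real L * p) + \<epsilon> + 2 powr (- (p + \<delta>) * real M)))"
    if PQ: "prob_on_real P" "prob_on_real Q" and pos: "0 < L" "0 < \<delta>" "0 < \<epsilon>"
      and shell: "\<forall>m. measure P (dyadic_shell m) + measure Q (dyadic_shell m)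
               \<le> K * 2 powr (- (2 * p + \<delta>) * real m)"
      and cell: "\<forall>m\<le>M. \<forall>l\<le>L. \<forall>F\<in>dyadic_partition l.
           cell_discrepancy P Q m F \<le> K * (2 + \<alpha>) powr (- real m * p) * \<epsilon> * e l"
    for P Q M L \<delta> \<epsilon>
  proof -
    interpret dyadic_discrepancy P Q M L K r "2 powr (- (2 * p + \<delta>))" \<epsilon> e
      unfolding r_def by (rule dyadic_discrepancyI) (use p \<alpha> K PQ pos e shell cell in auto)
    have "2 powr p * (2 powr p * 2 powr (- (2 * p + \<delta>))) = 2 powr (- \<delta>)"
      by (simp add: powr_add[symmetric])
    also have "\<dots> \<le> 2 powr 0" by (rule powr_mono) (use pos in auto)
    finally have "2 powr p * (2 powr p * 2 powr (- (2 * p + \<delta>))) \<le> 1" by simp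
    from wasserstein_powr_bound[OF p W sum[folded a_def] br this]
    have "ennreal_powr (wasserstein p P Q) p
          \<le> ennreal (K' * (2 powr (- real L * p) + \<epsilon> + (2 powr p * 2 powr (- (2 * p + \<delta>))) ^ M))"
      by (simp add: K'_def)
    also have "2 powr p * 2 powr (- (2 * p + \<delta>)) = 2 powr (- (p + \<delta>))"
      by (simp add: powr_add[symmetric])
    also have "(2 powr (- (p + \<delta>))) ^ M = 2 powr (- (p + \<delta>) * real M)"
      by (simp add: powr_powr flip: powr_realpow)
    finally show ?thesis .
  qed
  ultimately show ?thesis by blast
qed

text \<open>Comparison with the telescoping differences of reciprocals.\<close>

lemma sum_inverse_squares_le: "(\<Sum>j\<le>l. 1 / (real j + 1)\<^sup>2) \<le> 2 - 1 / (real l + 1)"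
proof (induction l)
  case (Suc l)
  have "1 / (real l + 2)\<^sup>2 \<le> 1 / ((real l + 1) * (real l + 2))"
    by (rule divide_left_mono) (auto simp: power2_eq_square)
  also have "\<dots> = 1 / (real l + 1) - 1 / (real l + 2)"
    by (simp add: divide_simps)
  finally show ?case using Suc by (simp add: add.commute)
qed simp

theorem lemma8p7:
  fixes p \<alpha> K :: real
  assumes "1 \<le> p" and "0 < \<alpha>" and "0 < K"
  shows
    "(\<exists>K'>0. \<forall>P Q (M::nat) (L::nat) (\<delta>::real) (\<epsilon>::real).
        prob_on_real P \<longrightarrow> prob_on_real Q \<longrightarrow> 0 < M \<longrightarrow> 0 < L \<longrightarrow> 0 < \<delta> \<longrightarrow> 0 < \<epsilon> \<longrightarrow>
        (\<forall>m. measure P (dyadic_shell m) + measure Q (dyadic_shell m)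
               \<le> K * 2 powr (- (2 * p + \<delta>) * real m)) \<longrightarrow>
        (\<forall>m\<le>M. \<forall>l\<le>L. \<forall>F\<in>dyadic_partition l.
           cell_discrepancy P Q m F \<le> K * (2 + \<alpha>) powr (- real m * p) * \<epsilon> / (real l + 1)\<^sup>2) \<longrightarrow>
        ennreal_powr (wasserstein p P Q) p
          \<le> ennreal (K' * (2 powr (- real L * p) + \<epsilon> + 2 powr (- (p + \<delta>) * real M)))) \<and>
     (1 < p \<longrightarrow>
      (\<exists>K'>0. \<forall>P Q (M::nat) (L::nat) (\<delta>::real) (\<epsilon>::real).
        prob_on_real P \<longrightarrow> prob_on_real Q \<longrightarrow> 0 < M \<longrightarrow> 0 < L \<longrightarrow> 0 < \<delta> \<longrightarrow> 0 < \<epsilon> \<longrightarrow>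
        (\<forall>m. measure P (dyadic_shell m) + measure Q (dyadic_shell m)
               \<le> K * 2 powr (- (2 * p + \<delta>) * real m)) \<longrightarrow>
        (\<forall>m\<le>M. \<forall>l\<le>L. \<forall>F\<in>dyadic_partition l.
           cell_discrepancy P Q m F \<le> K * (2 + \<alpha>) powr (- real m * p) * \<epsilon>) \<longrightarrow>
        ennreal_powr (wasserstein p P Q) p
          \<le> ennreal (K' * (2 powr (- real L * p) + \<epsilon> + 2 powr (- (p + \<delta>) * real M)))))"
    (is "?weighted \<and> (1 < p \<longrightarrow> ?unweighted)")
proof (rule conjI)
  have inv: "0 \<le> 1 / (real l + 1)\<^sup>2" "1 / (real l + 1)\<^sup>2 \<le> 1" for l
    by (simp_all add: divide_le_eq_1)
  have unweighted: "?unweighted" if "1 < p"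
  proof -
    define x where "x = 2 powr (1 - p)"
    have x: "0 \<le> x" "norm x < 1"
      using that powr_less_mono[of "1 - p" 0 2] by (simp_all add: x_def)
    \<comment> \<open>With constant weights, \<open>l + 1\<close> cells accumulate at level
      \<open>l\<close>; for \<open>1 < p\<close> the geometric factor still makes the sum over all
      levels converge.\<close>
    have "(\<Sum>l\<le>L. 2 powr (real l * (1 - p)) * (\<Sum>j\<le>l. 1)) \<le> 1 / (1 - x)\<^sup>2" for L
    proof -
      have sums: "(\<lambda>l. real (Suc l) * x ^ l) sums (1 / (1 - x)\<^sup>2)"
        by (rule geometric_deriv_sums) (rule x)
      have "(\<Sum>l\<le>L. 2 powr (real l * (1 - p)) * (\<Sum>j\<le>l. 1)) = (\<Sum>l\<le>L. real (Suc l) * x ^ l)"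
        by (rule sum.cong) (simp_all add: x_def powr_powr mult.commute flip: powr_realpow)
      also have "\<dots> \<le> (\<Sum>l. real (Suc l) * x ^ l)"
        by (rule sum_le_suminf) (use sums x in \<open>auto simp: sums_iff\<close>)
      finally show ?thesis using sums by (simp add: sums_iff)
    qed
    from wasserstein_powr_bound_of_level_weights[where e = "\<lambda>_. 1" and W = "\<lambda>L. {..L}",
        OF assms _ _ _ _ _ _ _ this]
    show ?thesis by simp
  qed
  show "1 < p \<longrightarrow> ?unweighted" using unweighted by blast
  show ?weighted
  proof (cases "p = 1")
    case True
    \<comment> \<open>For \<open>p = 1\<close> the geometric factor is 1, so only two levels are
      counted: 0 for pairs in different half-shells and \<open>L\<close> for pairs in the same one.
      The inverse squares keep the accumulated weight below 2 on each.\<close>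
    have "(\<Sum>l\<in>{0, L}. 2 powr (real l * (1 - p)) * (\<Sum>j\<le>l. 1 / (real j + 1)\<^sup>2)) \<le> 4" for L
    proof -
      have "(\<Sum>l\<in>{0, L}. 2 powr (real l * (1 - p)) * (\<Sum>j\<le>l. 1 / (real j + 1)\<^sup>2)) \<le> (\<Sum>l\<in>{0, L}. 2)"
      proof (rule sum_mono)
        fix l
        have "0 \<le> 1 / (real l + 1)" by simp
        then have "(\<Sum>j\<le>l. 1 / (real j + 1)\<^sup>2) \<le> 2"
          using sum_inverse_squares_le[of l] by linarith
        then show "2 powr (real l * (1 - p)) * (\<Sum>j\<le>l. 1 / (real j + 1)\<^sup>2) \<le> 2"
          using True by simp
      qed
      also have "\<dots> \<le> 4" by (cases "L = 0") auto
      finally show ?thesis .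
    qed
    from wasserstein_powr_bound_of_level_weights[where e = "\<lambda>l. 1 / (real l + 1)\<^sup>2"
        and W = "\<lambda>L. {0, L}", OF assms _ inv _ _ _ _ this]
    show ?thesis using True by simp
  next
    \<comment> \<open>For \<open>1 < p\<close> the weighted cell condition implies the unweighted
      one, so the other half of the theorem applies.\<close>
    case False
    then have "1 < p" using assms by simp
    from unweighted[OF this] obtain K' where "K' > 0" and K': "\<And>P Q (M::nat) (L::nat) (\<delta>::real) (\<epsilon>::real).
        prob_on_real P \<Longrightarrow> prob_on_real Q \<Longrightarrow> 0 < M \<Longrightarrow> 0 < L \<Longrightarrow> 0 < \<delta> \<Longrightarrow> 0 < \<epsilon> \<Longrightarrow>
        (\<forall>m. measure P (dyadic_shell m) + measure Q (dyadic_shell m)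
               \<le> K * 2 powr (- (2 * p + \<delta>) * real m)) \<Longrightarrow>
        (\<forall>m\<le>M. \<forall>l\<le>L. \<forall>F\<in>dyadic_partition l.
           cell_discrepancy P Q m F \<le> K * (2 + \<alpha>) powr (- real m * p) * \<epsilon>) \<Longrightarrow>
        ennreal_powr (wasserstein p P Q) p
          \<le> ennreal (K' * (2 powr (- real L * p) + \<epsilon> + 2 powr (- (p + \<delta>) * real M)))"
      by metis
    have weaker: "K * (2 + \<alpha>) powr (- real m * p) * \<epsilon> / (real l + 1)\<^sup>2 \<le> K * (2 + \<alpha>) powr (- real m * p) * \<epsilon>"
      if "0 < \<epsilon>" for m l and \<epsilon> :: real
      using mult_left_mono[OF inv(2), of "K * (2 + \<alpha>) powr (- real m * p) * \<epsilon>" l] that assms by simp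
    show ?thesis
    proof (intro exI[of _ K'] conjI allI impI)
      show "K' > 0" by fact
    next
      fix P Q :: "real measure" and M L :: nat and \<delta> \<epsilon> :: real
      assume pos: "prob_on_real P" "prob_on_real Q" "0 < M" "0 < L" "0 < \<delta>" "0 < \<epsilon>"
        and shell: "\<forall>m. measure P (dyadic_shell m) + measure Q (dyadic_shell m)
               \<le> K * 2 powr (- (2 * p + \<delta>) * real m)"
        and cell: "\<forall>m\<le>M. \<forall>l\<le>L. \<forall>F\<in>dyadic_partition l.
           cell_discrepancy P Q m F \<le> K * (2 + \<alpha>) powr (- real m * p) * \<epsilon> / (real l + 1)\<^sup>2"
      have "\<forall>m\<le>M. \<forall>l\<le>L. \<forall>F\<in>dyadic_partition l.
           cell_discrepancy P Q m F \<le> K * (2 + \<alpha>) powr (- real m * p) * \<epsilon>"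
        using cell weaker[OF \<open>0 < \<epsilon>\<close>] by (meson order_trans)
      then show "ennreal_powr (wasserstein p P Q) p
          \<le> ennreal (K' * (2 powr (- real L * p) + \<epsilon> + 2 powr (- (p + \<delta>) * real M)))"
        using pos shell by (intro K')
    qed
  qed
qed

end
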